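(* Let $H(V,E)$ be the complete $r$-uniform hypergraph with $n$ vertices ($1\le r\le n$). Then its edge-domatic number satisfies $ed(H)=\binom{n}{r}$ if $r>\lfloor n/2\rfloor$, and $ed(H)=\binom{n}{r}\big/\tfrac{n}{r}$ if $r\le\lfloor n/2\rfloor$ and $r$ divides $n$.
   Context: A hypergraph $H(V,E)$ has a finite vertex set $V$ and a set $E$ of hyperedges, each a subset of $V$; it is $r$-uniform if every hyperedge has exactly $r$ vertices. The complete $r$-uniform hypergraph on $n$ vertices has as hyperedges all $r$-element subsets of $V$. Two distinct hyperedges are adjacent if they share at least one vertex. An edge-dominating set is a subset $E_d\subseteq E$ such that every hyperedge in $E\setminus E_d$ is adjacent to some hyperedge in $E_d$. The edge-domatic number $ed(H)$ is the maximum number of classes in a partition of $E$ into edge-dominating sets. *)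

theory Defs
  imports Complex_Main "HOL-Library.Disjoint_Sets"
begin

definition hypergraph :: "'a set \<Rightarrow> 'a set set \<Rightarrow> bool" where
  "hypergraph V E \<longleftrightarrow> finite V \<and> E \<subseteq> Pow V"

definition uniform_hypergraph :: "nat \<Rightarrow> 'a set \<Rightarrow> 'a set set \<Rightarrow> bool" where
  "uniform_hypergraph r V E \<longleftrightarrow> hypergraph V E \<and> (\<forall>e\<in>E. card e = r)"

definition complete_uniform_hypergraph :: "nat \<Rightarrow> 'a set \<Rightarrow> 'a set set \<Rightarrow> bool" where
  "complete_uniform_hypergraph r V E \<longleftrightarrow>
     uniform_hypergraph r V E \<and> (\<forall>e. e \<subseteq> V \<and> card e = r \<longrightarrow> e \<in> E)"

definition adjacent_edges :: "'a set \<Rightarrow> 'a set \<Rightarrow> bool" where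
  "adjacent_edges e f \<longleftrightarrow> e \<noteq> f \<and> e \<inter> f \<noteq> {}"

definition edge_dominating :: "'a set set \<Rightarrow> 'a set set \<Rightarrow> bool" where
  "edge_dominating E D \<longleftrightarrow> D \<subseteq> E \<and> (\<forall>e\<in>E - D. \<exists>f\<in>D. adjacent_edges e f)"

(* For finite E the set below is finite and nonempty (it contains the count of the partition
   with at most one class), so Max is a genuine maximum. Classes of partition_on are nonempty. *)
definition edge_domatic_number :: "'a set set \<Rightarrow> nat" where
  "edge_domatic_number E =
     Max {card P | P. partition_on E P \<and> (\<forall>D\<in>P. edge_dominating E D)}"

end

theory Submission
  imports Defs
begin

text \<open>
  When \<open>r > n div 2\<close> any two edges meet, so every single edge dominates.

  Suppose \<open>n = k * r\<close>. An edge-dominating set must cover more than \<open>n - r\<close> vertices, because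
  \<open>r\<close> uncovered vertices would form an undominated edge; hence it has at least \<open>k\<close> members, which
  bounds the number of classes by \<open>(n choose r) / k\<close>. The bound is attained by Baranyai's theorem:
  the edges can be partitioned into perfect matchings, each of which is dominating.

  Baranyai's theorem is proved by revealing the vertices one at a time. For the set \<open>U\<close> of revealed
  vertices one keeps \<open>(n choose r) / k\<close> partitions of \<open>U\<close> into \<open>k\<close> possibly empty parts, such that
  every \<open>S \<subseteq> U\<close> occurs altogether as often as there are edges meeting \<open>U\<close> exactly in \<open>S\<close>. To reveal
  a further vertex, every partition has to choose the part that receives it, with a prescribed
  number of choices of each \<open>S\<close>. Giving the part \<open>S\<close> of a partition the weight
  \<open>(r - card S) / (n - card U)\<close> is a fractional solution of this problem, which verifies the
  condition of Hall's theorem and hence yields an integral one.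
\<close>

section \<open>Hall's theorem\<close>

text \<open>Halmos-Vaughan induction: if some nonempty proper \<open>J\<close> is tight,
  \<open>J\<close> and its complement are matched separately; otherwise every such \<open>J\<close>
  has a neighbour to spare, so one choice can be fixed arbitrarily.\<close>

theorem hall:
  assumes "finite I" "\<And>i. i \<in> I \<Longrightarrow> finite (A i)"
    and "\<And>J. J \<subseteq> I \<Longrightarrow> card J \<le> card (\<Union>(A ` J))"
  shows "\<exists>g. inj_on g I \<and> (\<forall>i\<in>I. g i \<in> A i)"
  using assms
proof (induction I arbitrary: A rule: finite_psubset_induct)
  case (psubset I)
  note fin = psubset.prems(1) and hall = psubset.prems(2)
  have finU: "finite (\<Union>(A ` J))" if "J \<subseteq> I" for J
    using that fin psubset.hyps by (auto intro: finite_subset)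
  consider "I = {}"
    | J where "J \<noteq> {}" "J \<subset> I" "card (\<Union>(A ` J)) = card J"
    | i where "i \<in> I" "\<And>J. J \<noteq> {} \<Longrightarrow> J \<subset> I \<Longrightarrow> card J < card (\<Union>(A ` J))"
    using hall by (metis ex_in_conv order_le_imp_less_or_eq psubset_imp_subset)
  then show ?case
  proof cases
    case 1
    then show ?thesis by simp
  next
    case (2 J)
    have "J \<subseteq> I" using 2 by blast
    define B where "B i = A i - \<Union>(A ` J)" for i
    have "\<exists>g. inj_on g J \<and> (\<forall>i\<in>J. g i \<in> A i)"
      using \<open>J \<subseteq> I\<close> by (intro psubset.IH \<open>J \<subset> I\<close> fin hall) auto
    then obtain g where g: "inj_on g J" "\<And>i. i \<in> J \<Longrightarrow> g i \<in> A i"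
      by blast
    have "card K \<le> card (\<Union>(B ` K))" if K: "K \<subseteq> I - J" for K
    proof -
      have finK: "finite J" "finite K"
        using K \<open>J \<subseteq> I\<close> psubset.hyps by (auto intro: finite_subset)
      \<comment> \<open>Hall's condition for \<open>J \<union> K\<close>, minus the tight part
        \<open>J\<close>, leaves the condition for \<open>K\<close> outside the neighbours of
        \<open>J\<close>.\<close>
      have "card J + card K = card (J \<union> K)"
        using K finK by (subst card_Un_disjoint) auto
      also have "\<dots> \<le> card (\<Union>(A ` (J \<union> K)))"
        using K \<open>J \<subseteq> I\<close> by (intro hall) auto
      also have "\<Union>(A ` (J \<union> K)) = \<Union>(A ` J) \<union> \<Union>(B ` K)"
        by (auto simp: B_def)
      also have "card \<dots> \<le> card (\<Union>(A ` J)) + card (\<Union>(B ` K))"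
        by (rule card_Un_le)
      finally show ?thesis
        using 2 by simp
    qed
    then have "\<exists>h. inj_on h (I - J) \<and> (\<forall>i\<in>I - J. h i \<in> B i)"
      using 2 by (intro psubset.IH) (auto simp: B_def fin)
    then obtain h where h: "inj_on h (I - J)" "\<And>i. i \<in> I - J \<Longrightarrow> h i \<in> B i"
      by blast
    define f where "f i = (if i \<in> J then g i else h i)" for i
    have "inj_on f I"
    proof (rule inj_onI)
      fix x y assume xy: "x \<in> I" "y \<in> I" "f x = f y"
      then show "x = y"
        using g(2)[of x] g(2)[of y] h(2)[of x] h(2)[of y] inj_onD[OF g(1), of x y]
          inj_onD[OF h(1), of x y]
        by (auto simp: f_def B_def split: if_splits)
    qed
    moreover have "\<forall>i\<in>I. f i \<in> A i"
      using g(2) h(2) by (auto simp: f_def B_def)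
    ultimately show ?thesis by blast
  next
    case (3 i)
    have "card {i} \<le> card (\<Union>(A ` {i}))"
      using 3 by (intro hall) auto
    then obtain a where a: "a \<in> A i"
      by fastforce
    define B where "B j = A j - {a}" for j
    have "card K \<le> card (\<Union>(B ` K))" if K: "K \<subseteq> I - {i}" for K
    proof (cases "K = {}")
      case False
      have "card K < card (\<Union>(A ` K))"
        using K False 3 by (intro 3) auto
      moreover have "\<Union>(B ` K) = \<Union>(A ` K) - {a}"
        by (auto simp: B_def)
      ultimately show ?thesis
        using finU[of K] K by (cases "a \<in> \<Union>(A ` K)") auto
    qed simp
    then have "\<exists>h. inj_on h (I - {i}) \<and> (\<forall>j\<in>I - {i}. h j \<in> B j)"
      using 3 by (intro psubset.IH) (auto simp: B_def fin)
    then obtain h where h: "inj_on h (I - {i})" "\<And>j. j \<in> I - {i} \<Longrightarrow> h j \<in> B j"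
      by blast
    have "inj_on (h(i := a)) I"
      using h by (fastforce simp: inj_on_def B_def)
    moreover have "\<forall>j\<in>I. (h(i := a)) j \<in> A j"
      using h a by (auto simp: B_def)
    ultimately show ?thesis by blast
  qed
qed

text \<open>Split each \<open>S\<close> into \<open>c S\<close> copies. An injective choice of
  copies uses \<open>S\<close> at most \<open>c S\<close> times, and \<open>total\<close> forces
  every copy to be used.\<close>

corollary hall_with_multiplicities:
  fixes c :: "'b \<Rightarrow> nat"
  assumes "finite I" "finite T" "\<And>i. i \<in> I \<Longrightarrow> A i \<subseteq> T"
    and hall_cond: "\<And>J. J \<subseteq> I \<Longrightarrow> card J \<le> sum c (\<Union>(A ` J))"
    and total: "sum c T = card I"
  shows "\<exists>g. (\<forall>i\<in>I. g i \<in> A i) \<and> (\<forall>S\<in>T. card {i \<in> I. g i = S} = c S)"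
proof -
  define B where "B i = Sigma (A i) (\<lambda>S. {..<c S})" for i
  have finA: "finite (A i)" if "i \<in> I" for i
    using that assms by (auto intro: finite_subset)
  have "\<exists>g. inj_on g I \<and> (\<forall>i\<in>I. g i \<in> B i)"
  proof (rule hall)
    fix J assume J: "J \<subseteq> I"
    have "finite (\<Union>(A ` J))"
      using J finA finite_subset[OF J \<open>finite I\<close>] by auto
    moreover have "\<Union>(B ` J) = Sigma (\<Union>(A ` J)) (\<lambda>S. {..<c S})"
      by (auto simp: B_def)
    ultimately show "card J \<le> card (\<Union>(B ` J))"
      using hall_cond[OF J] by simp
  qed (use assms finA in \<open>auto simp: B_def\<close>)
  then obtain g where g: "inj_on g I" "\<And>i. i \<in> I \<Longrightarrow> g i \<in> B i"
    by blast
  let ?T = "Sigma T (\<lambda>S. {..<c S})"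
  have "g ` I = ?T"
  proof (rule card_subset_eq)
    show "finite ?T" using assms by simp
    show "g ` I \<subseteq> ?T" using g(2) assms(3) by (fastforce simp: B_def)
    show "card (g ` I) = card ?T"
      using assms card_image[OF g(1)] by simp
  qed
  moreover have "g ` {i \<in> I. fst (g i) = S} = {p \<in> g ` I. fst p = S}" for S
    by auto
  ultimately have image: "g ` {i \<in> I. fst (g i) = S} = {S} \<times> {..<c S}" if "S \<in> T" for S
    using that by auto
  have "card {i \<in> I. fst (g i) = S} = c S" if "S \<in> T" for S
  proof -
    have "inj_on g {i \<in> I. fst (g i) = S}"
      by (rule inj_on_subset[OF g(1)]) auto
    from card_image[OF this] show ?thesis
      using image[OF that] by (simp add: card_cartesian_product)
  qed
  moreover have "\<forall>i\<in>I. fst (g i) \<in> A i"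
    using g(2) by (fastforce simp: B_def)
  ultimately show ?thesis
    by (intro exI[of _ "\<lambda>i. fst (g i)"]) auto
qed

section \<open>Baranyai's theorem\<close>

text \<open>The number of ways to extend an \<open>s\<close>-set to an \<open>r\<close>-set by elements of a disjoint \<open>m\<close>-set.\<close>

definition extension_count :: "nat \<Rightarrow> nat \<Rightarrow> nat \<Rightarrow> nat" where
  "extension_count r m s = (if s \<le> r then m choose (r - s) else 0)"

text \<open>Pascal's rule: a fixed hidden vertex either stays out of the extension or joins
  it.\<close>

lemma extension_count_Suc:
  "extension_count r (Suc m) s = extension_count r m s + extension_count r m (Suc s)"
proof (cases "s < r")
  case True
  then obtain d where "r = Suc (s + d)"
    using less_imp_Suc_add by blast
  then show ?thesis by (simp add: extension_count_def Suc_diff_le)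
qed (auto simp: extension_count_def)

text \<open>Double counting of extensions with one added vertex marked.\<close>

lemma extension_count_absorb:
  "extension_count r (Suc m) s * (r - s) = Suc m * extension_count r m (Suc s)"
proof (cases "s < r")
  case True
  then obtain d where "r = Suc (s + d)"
    using less_imp_Suc_add by blast
  then show ?thesis
    using Suc_times_binomial[of d m] by (simp add: extension_count_def Suc_diff_le mult.commute)
qed (auto simp: extension_count_def)

text \<open>
  The \<open>M\<close> partitions of the set \<open>U\<close> of revealed vertices, when \<open>m\<close> vertices are still hidden. They
  are indexed families because the empty part may occur repeatedly.
\<close>

definition partial_baranyai ::
  "nat \<Rightarrow> nat \<Rightarrow> nat \<Rightarrow> nat \<Rightarrow> 'a set \<Rightarrow> (nat \<Rightarrow> nat \<Rightarrow> 'a set) \<Rightarrow> bool" where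
  "partial_baranyai r k M m U f \<longleftrightarrow>
     (\<forall>i<M. disjoint_family_on (f i) {..<k} \<and> (\<Union>j<k. f i j) = U) \<and>
     (\<forall>S\<subseteq>U. card {p \<in> {..<M} \<times> {..<k}. f (fst p) (snd p) = S} = extension_count r m (card S))"

lemma sum_comp_eq_sum_card_fibre:
  fixes h :: "'b \<Rightarrow> nat"
  assumes "finite X"
  shows "(\<Sum>x\<in>X. h (f x)) = (\<Sum>y\<in>f ` X. card {x \<in> X. f x = y} * h y)"
  using sum_fun_comp[OF assms, of "f ` X" f h] assms by simp

lemma partial_baranyai_step:
  assumes f: "partial_baranyai r k M (Suc m) U f"
    and U: "finite U" "card U + Suc m = k * r" and x: "x \<notin> U"
  shows "\<exists>f'. partial_baranyai r k M m (insert x U) f'"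
proof -
  define count where "count S = card {p \<in> {..<M} \<times> {..<k}. f (fst p) (snd p) = S}" for S
  \<comment> \<open>The number of edges with trace \<open>insert x S\<close> on
    \<open>insert x U\<close>, hence how often a part \<open>S\<close> has to receive
    \<open>x\<close>.\<close>
  define c where "c S = extension_count r m (Suc (card S))" for S :: "'a set"
  have disj: "disjoint_family_on (f i) {..<k}" and un: "(\<Union>j<k. f i j) = U" if "i < M" for i
    using f that by (auto simp: partial_baranyai_def)
  have count: "count S = extension_count r (Suc m) (card S)" if "S \<subseteq> U" for S
    using f that by (auto simp: partial_baranyai_def count_def)
  have sub: "f i j \<subseteq> U" if "i < M" "j < k" for i j
    using un that by blast
  \<comment> \<open>A larger part would have count 0. Hence the truncated difference
    \<open>r - card (f i j)\<close> is a true one.\<close>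
  have le_r: "card (f i j) \<le> r" if ij: "i < M" "j < k" for i j
  proof -
    have "(i, j) \<in> {p \<in> {..<M} \<times> {..<k}. f (fst p) (snd p) = f i j}"
      using ij by simp
    then have "count (f i j) \<noteq> 0"
      unfolding count_def by (subst card_0_eq) auto
    then show ?thesis
      using count[OF sub[OF ij]] by (auto simp: extension_count_def split: if_splits)
  qed
  \<comment> \<open>The fractional weights are scaled by \<open>Suc m\<close> to stay in the
    naturals, so each partition carries \<open>Suc m\<close> instead of 1.\<close>
  have weight: "(\<Sum>j<k. r - card (f i j)) = Suc m" if i: "i < M" for i
  proof -
    have "card U = (\<Sum>j<k. card (f i j))"
      using disj[OF i] finite_subset[OF sub[OF i] U(1)]
      by (subst un[OF i, symmetric], intro card_UN_disjoint) (auto simp: disjoint_family_on_def)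
    moreover have "(\<Sum>j<k. r - card (f i j)) + (\<Sum>j<k. card (f i j)) = (\<Sum>j<k. r)"
      unfolding sum.distrib[symmetric] using le_r[OF i] by (intro sum.cong) auto
    ultimately show ?thesis using U(2) by simp
  qed
  \<comment> \<open>The scaled weights of all occurrences of \<open>S\<close> add up to its demand
    \<open>c S\<close>, scaled alike.\<close>
  have absorb: "count S * (r - card S) = Suc m * c S" if "S \<subseteq> U" for S
    using count[OF that] extension_count_absorb[of r m "card S"] by (simp add: c_def)
  have total: "Suc m * card J = (\<Sum>S\<in>(\<Union>i\<in>J. f i ` {..<k}).
      card {p \<in> J \<times> {..<k}. f (fst p) (snd p) = S} * (r - card S))" if J: "J \<subseteq> {..<M}" for J
  proof -
    have "Suc m * card J = (\<Sum>i\<in>J. \<Sum>j<k. r - card (f i j))"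
      using weight J by (subst sum.cong[OF refl, of J _ "\<lambda>_. Suc m"]) auto
    also have "\<dots> = (\<Sum>p\<in>J \<times> {..<k}. r - card (f (fst p) (snd p)))"
      by (simp add: sum.cartesian_product case_prod_unfold)
    also have "\<dots> = (\<Sum>S\<in>(\<lambda>p. f (fst p) (snd p)) ` (J \<times> {..<k}).
        card {p \<in> J \<times> {..<k}. f (fst p) (snd p) = S} * (r - card S))"
      using J finite_subset[OF J]
      by (intro sum_comp_eq_sum_card_fibre[where h = "\<lambda>S. r - card S"]) auto
    also have "(\<lambda>p. f (fst p) (snd p)) ` (J \<times> {..<k}) = (\<Union>i\<in>J. f i ` {..<k})"
      by force
    finally show ?thesis .
  qed
  have "\<exists>g. (\<forall>i\<in>{..<M}. g i \<in> f i ` {..<k}) \<and> (\<forall>S\<in>Pow U. card {i \<in> {..<M}. g i = S} = c S)"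
  proof (rule hall_with_multiplicities)
    show "f i ` {..<k} \<subseteq> Pow U" if "i \<in> {..<M}" for i
      using sub that by auto
    show "card J \<le> sum c (\<Union>i\<in>J. f i ` {..<k})" if J: "J \<subseteq> {..<M}" for J
    proof -
      \<comment> \<open>The partitions in \<open>J\<close> contain only some of the occurrences of
        each \<open>S\<close>.\<close>
      have "Suc m * card J \<le> (\<Sum>S\<in>(\<Union>i\<in>J. f i ` {..<k}). count S * (r - card S))"
        unfolding total[OF J] count_def using J
        by (intro sum_mono mult_right_mono card_mono) auto
      also have "\<dots> = (\<Sum>S\<in>(\<Union>i\<in>J. f i ` {..<k}). Suc m * c S)"
        using J sub by (intro sum.cong refl absorb) blast
      also have "\<dots> = Suc m * sum c (\<Union>i\<in>J. f i ` {..<k})"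
        by (simp only: sum_distrib_left)
      finally show ?thesis by (simp only: Suc_mult_le_cancel1)
    qed
    \<comment> \<open>For all partitions together there is equality; sets that never occur have
      count 0 and may join the sum.\<close>
    have "Suc m * card {..<M} = (\<Sum>S\<in>(\<Union>i<M. f i ` {..<k}). count S * (r - card S))"
      unfolding count_def by (rule total) simp
    also have "\<dots> = (\<Sum>S\<in>Pow U. count S * (r - card S))"
    proof (rule sum.mono_neutral_left)
      show "\<forall>S\<in>Pow U - (\<Union>i<M. f i ` {..<k}). count S * (r - card S) = 0"
      proof
        fix S assume "S \<in> Pow U - (\<Union>i<M. f i ` {..<k})"
        then have "{p \<in> {..<M} \<times> {..<k}. f (fst p) (snd p) = S} = {}"
          by auto
        then show "count S * (r - card S) = 0"
          by (simp only: count_def) simp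
      qed
    qed (use sub U in auto)
    also have "\<dots> = (\<Sum>S\<in>Pow U. Suc m * c S)"
      by (intro sum.cong refl absorb) auto
    also have "\<dots> = Suc m * sum c (Pow U)"
      by (simp only: sum_distrib_left)
    finally show "sum c (Pow U) = card {..<M}"
      by (simp only: Suc_mult_cancel1)
  qed (use U in auto)
  then obtain g where g: "\<And>i. i < M \<Longrightarrow> g i \<in> f i ` {..<k}"
    "\<And>S. S \<subseteq> U \<Longrightarrow> card {i \<in> {..<M}. g i = S} = c S"
    by (metis PowI lessThan_iff)
  \<comment> \<open>\<open>g\<close> picks a set, \<open>t\<close> a position: if the empty part is
    repeated, only one copy may receive \<open>x\<close>.\<close>
  then have "\<forall>i. \<exists>j. i < M \<longrightarrow> j < k \<and> g i = f i j"
    by blast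
  then obtain t where t: "\<And>i. i < M \<Longrightarrow> t i < k" "\<And>i. i < M \<Longrightarrow> g i = f i (t i)"
    by metis
  define f' where "f' i j = (if j = t i then insert x (f i j) else f i j)" for i j
  have chosen: "card ((\<lambda>i. (i, t i)) ` {i \<in> {..<M}. g i = S}) = c S" if "S \<subseteq> U" for S
    using g(2)[OF that] by (subst card_image) (auto simp: inj_on_def)
  have "disjoint_family_on (f' i) {..<k} \<and> (\<Union>j<k. f' i j) = insert x U" if i: "i < M" for i
  proof
    show "disjoint_family_on (f' i) {..<k}"
      using disj[OF i] sub[OF i] x by (auto simp: disjoint_family_on_def f'_def)
    show "(\<Union>j<k. f' i j) = insert x U"
      using un[OF i] t(1)[OF i] by (auto simp: f'_def split: if_splits)
  qed
  moreover have "card {p \<in> {..<M} \<times> {..<k}. f' (fst p) (snd p) = S} = extension_count r m (card S)"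
    if S: "S \<subseteq> insert x U" for S
  proof (cases "x \<in> S")
    case True
    have S': "S - {x} \<subseteq> U" using S by auto
    have "{p \<in> {..<M} \<times> {..<k}. f' (fst p) (snd p) = S}
        = (\<lambda>i. (i, t i)) ` {i \<in> {..<M}. g i = S - {x}}" (is "?L = ?R")
    proof
      show "?L \<subseteq> ?R"
        using True sub x t by (fastforce simp: f'_def split: if_splits)
      show "?R \<subseteq> ?L"
        using True t by (auto simp: f'_def)
    qed
    moreover have "card S = Suc (card (S - {x}))"
      using True S U(1) by (metis card.remove finite.insertI finite_subset)
    ultimately show ?thesis
      using chosen[OF S'] by (simp add: c_def)
  next
    case False
    then have S': "S \<subseteq> U" using S by auto
    let ?C = "(\<lambda>i. (i, t i)) ` {i \<in> {..<M}. g i = S}"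
    \<comment> \<open>The old occurrences of \<open>S\<close> survive except the chosen ones;
      Pascal's rule then gives their number.\<close>
    have "{p \<in> {..<M} \<times> {..<k}. f' (fst p) (snd p) = S}
        = {p \<in> {..<M} \<times> {..<k}. f (fst p) (snd p) = S} - ?C"
      using False t by (auto simp: f'_def split: if_splits)
    also have "card \<dots> = count S - c S"
      unfolding count_def chosen[OF S', symmetric] using t by (intro card_Diff_subset) auto
    finally show ?thesis
      using count[OF S'] extension_count_Suc[of r m "card S"] by (simp add: c_def)
  qed
  ultimately have "partial_baranyai r k M m (insert x U) f'"
    by (auto simp: partial_baranyai_def)
  then show ?thesis by blast
qed

text \<open>At the start all \<open>M * k\<close> parts are empty, and all
  \<open>(k * r) choose r\<close> edges have empty trace, so the assumption on \<open>M\<close> is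
  the base case.\<close>

lemma partial_baranyai_exists:
  assumes "finite V" "card V = k * r" "M * k = (k * r) choose r" and "U \<subseteq> V"
  shows "\<exists>f. partial_baranyai r k M (k * r - card U) U f"
  using finite_subset[OF assms(4,1)] assms(4)
proof (induction U rule: finite_induct)
  case empty
  have "{p \<in> {..<M} \<times> {..<k}. ({} :: 'a set) = {}} = {..<M} \<times> {..<k}"
    by auto
  then have "partial_baranyai r k M (k * r) {} (\<lambda>_ _. {})"
    using assms(3) by (auto simp: partial_baranyai_def disjoint_family_on_def extension_count_def)
  then show ?case by auto
next
  case (insert x U)
  have "card (insert x U) \<le> k * r"
    using card_mono[OF assms(1) insert.prems] assms(2) by simp
  then have less: "card U < k * r"
    using insert.hyps by simp
  define m where "m = k * r - Suc (card U)"
  have m: "k * r - card U = Suc m" "k * r - card (insert x U) = m" "card U + Suc m = k * r"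
    using less insert.hyps by (auto simp: m_def)
  obtain f where "partial_baranyai r k M (Suc m) U f"
    using insert m by auto
  from partial_baranyai_step[OF this \<open>finite U\<close> m(3) \<open>x \<notin> U\<close>] show ?case
    using m by simp
qed

theorem baranyai:
  assumes V: "finite V" "card V = k * r" and "0 < k" and M: "M * k = (k * r) choose r"
  shows "\<exists>P. partition_on {e. e \<subseteq> V \<and> card e = r} P \<and> card P = M \<and> (\<forall>D\<in>P. \<Union>D = V)"
proof -
  obtain f where "partial_baranyai r k M (k * r - card V) V f"
    using partial_baranyai_exists[OF V M, of V] by blast
  \<comment> \<open>With no vertex hidden, \<open>extension_count\<close> is the indicator of size
    \<open>r\<close>: each edge occurs at exactly one position, and nothing else occurs.\<close>
  then have un: "\<And>i. i < M \<Longrightarrow> (\<Union>j<k. f i j) = V"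
    and count: "\<And>S. S \<subseteq> V \<Longrightarrow>
      card {p \<in> {..<M} \<times> {..<k}. f (fst p) (snd p) = S} = (if card S = r then 1 else 0)"
    by (auto simp: partial_baranyai_def extension_count_def V)
  have sub: "f i j \<subseteq> V" if "i < M" "j < k" for i j
    using un that by blast
  have card_f: "card (f i j) = r" if ij: "i < M" "j < k" for i j
  proof (rule ccontr)
    assume "card (f i j) \<noteq> r"
    then have "{p \<in> {..<M} \<times> {..<k}. f (fst p) (snd p) = f i j} = {}"
      using count[OF sub[OF ij]] by (subst card_0_eq[symmetric]) auto
    then show False using ij by auto
  qed
  have ex: "\<exists>i<M. \<exists>j<k. f i j = S" if S: "S \<subseteq> V" "card S = r" for S
  proof -
    obtain p where "{p \<in> {..<M} \<times> {..<k}. f (fst p) (snd p) = S} = {p}"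
      using count[OF S(1)] S(2) by (auto simp: card_1_singleton_iff)
    then have "p \<in> {p \<in> {..<M} \<times> {..<k}. f (fst p) (snd p) = S}"
      by simp
    then show ?thesis by (auto simp: mem_Times_iff)
  qed
  have unique: "i = i'" if ij: "i < M" "j < k" "i' < M" "j' < k" and eq: "f i j = f i' j'"
    for i j i' j'
  proof -
    obtain p where p: "{p \<in> {..<M} \<times> {..<k}. f (fst p) (snd p) = f i j} = {p}"
      using count[OF sub[OF ij(1,2)]] card_f[OF ij(1,2)] by (auto simp: card_1_singleton_iff)
    have "(i, j) \<in> {p}" "(i', j') \<in> {p}"
      unfolding p[symmetric] using ij eq by auto
    then show ?thesis by auto
  qed
  let ?P = "(\<lambda>i. f i ` {..<k}) ` {..<M}"
  have "inj_on (\<lambda>i. f i ` {..<k}) {..<M}"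
  proof (rule inj_onI)
    fix i i' assume i: "i \<in> {..<M}" "i' \<in> {..<M}" and eq: "f i ` {..<k} = f i' ` {..<k}"
    have "f i 0 \<in> f i' ` {..<k}"
      unfolding eq[symmetric] using \<open>0 < k\<close> by auto
    then show "i = i'"
      using unique[of i 0 i'] i \<open>0 < k\<close> by auto
  qed
  then have "card ?P = M"
    by (simp add: card_image)
  moreover have "partition_on {e. e \<subseteq> V \<and> card e = r} ?P"
  proof (rule partition_onI)
    show "\<Union>?P = {e. e \<subseteq> V \<and> card e = r}"
    proof (intro equalityI subsetI)
      fix e assume "e \<in> {e. e \<subseteq> V \<and> card e = r}"
      then obtain i j where "i < M" "j < k" "f i j = e"
        using ex by blast
      then show "e \<in> \<Union>?P" by auto
    qed (use sub card_f in auto)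
    show "disjnt D D'" if D: "D \<in> ?P" "D' \<in> ?P" "D \<noteq> D'" for D D'
    proof -
      obtain i i' where i: "i < M" "i' < M" "D = f i ` {..<k}" "D' = f i' ` {..<k}"
        using D(1,2) by blast
      with D(3) have "i \<noteq> i'" by blast
      with i show ?thesis
        using unique[of i _ i'] by (auto simp: disjnt_iff)
    qed
    show "{} \<notin> ?P"
      using \<open>0 < k\<close> by auto
  qed
  ultimately show ?thesis
    using un by (intro exI[of _ ?P]) auto
qed

section \<open>The edge-domatic number\<close>

lemma edge_domatic_number_eqI:
  assumes "finite E" "partition_on E P" "\<And>D. D \<in> P \<Longrightarrow> edge_dominating E D" "card P = N"
    and "\<And>Q. partition_on E Q \<Longrightarrow> (\<And>D. D \<in> Q \<Longrightarrow> edge_dominating E D) \<Longrightarrow> card Q \<le> N"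
  shows "edge_domatic_number E = N"
  unfolding edge_domatic_number_def
proof (rule Max_eqI)
  \<comment> \<open>The upper bound \<open>N\<close> also supplies the finiteness that
    \<open>Max\<close> needs.\<close>
  show "finite {card P |P. partition_on E P \<and> (\<forall>D\<in>P. edge_dominating E D)}"
    using assms(5) by (auto intro!: finite_subset[of _ "{..N}"])
qed (use assms in auto)

lemma card_partition_on_mult_le:
  assumes "finite E" "partition_on E P" "\<And>D. D \<in> P \<Longrightarrow> k \<le> card D"
  shows "card P * k \<le> card E"
proof -
  have "card P * k = (\<Sum>D\<in>P. k)"
    by simp
  also have "\<dots> \<le> (\<Sum>D\<in>P. card D)"
    by (intro sum_mono assms)
  also have "\<dots> = card E"
    using product_partition[OF assms(2)] assms(1) finite_elements[OF assms(1,2)]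
      partition_onD1[OF assms(2)]
    by (metis Union_upper finite_subset)
  finally show ?thesis .
qed

lemma edge_dominating_if_covering:
  assumes "D \<subseteq> E" "E \<subseteq> Pow V" "{} \<notin> E" "\<Union>D = V"
  shows "edge_dominating E D"
  unfolding edge_dominating_def
proof (intro conjI ballI)
  fix e assume e: "e \<in> E - D"
  with assms obtain v where "v \<in> e"
    by (metis DiffD1 ex_in_conv)
  with e assms obtain f where "f \<in> D" "v \<in> f"
    by blast
  with e \<open>v \<in> e\<close> show "\<exists>f\<in>D. adjacent_edges e f"
    by (auto simp: adjacent_edges_def)
qed (fact assms(1))

lemma edge_dominating_card_ge:
  assumes E: "E = {e. e \<subseteq> V \<and> card e = r}" and V: "finite V" "card V = k * r" and "0 < r"
    and D: "edge_dominating E D"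
  shows "k \<le> card D"
proof (rule ccontr)
  assume "\<not> k \<le> card D"
  \<comment> \<open>With fewer than \<open>k\<close> members of size \<open>r\<close>, at least
    \<open>r\<close> of the \<open>k * r\<close> vertices stay uncovered.\<close>
  then have "Suc (card D) * r \<le> k * r"
    by (intro mult_right_mono) auto
  moreover have "card (\<Union>D) \<le> card D * r"
  proof -
    have "card (\<Union>D) \<le> (\<Sum>e\<in>D. card e)"
      by (rule card_Union_le_sum_card)
    also have "\<dots> = card D * r"
      using D by (subst sum.cong[OF refl, of D _ "\<lambda>_. r"]) (auto simp: edge_dominating_def E)
    finally show ?thesis .
  qed
  moreover have "\<Union>D \<subseteq> V"
    using D by (auto simp: edge_dominating_def E)
  ultimately have "r \<le> card (V - \<Union>D)"
    using V by (simp add: card_Diff_subset finite_subset)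
  then obtain e where e: "e \<subseteq> V - \<Union>D" "card e = r"
    by (meson obtain_subset_with_card_n)
  then have "e \<in> E" "e \<noteq> {}"
    using \<open>0 < r\<close> by (auto simp: E)
  moreover have "e \<inter> f = {}" if "f \<in> D" for f
    using e(1) that by blast
  \<comment> \<open>Being nonempty and disjoint from every member of \<open>D\<close>,
    \<open>e\<close> is not in \<open>D\<close> itself, so it would have to be dominated.\<close>
  ultimately show False
    using D unfolding edge_dominating_def adjacent_edges_def by (metis DiffI Int_absorb)
qed

theorem theorem4:
  fixes V :: "'a set" and E :: "'a set set" and n r :: nat
  assumes "complete_uniform_hypergraph r V E"
    and "card V = n"
    and "1 \<le> r" and "r \<le> n"
  shows "(r > n div 2 \<longrightarrow> edge_domatic_number E = n choose r) \<and>
         (r \<le> n div 2 \<and> r dvd n \<longrightarrow>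
            real (edge_domatic_number E) = real (n choose r) / (real n / real r))"
proof (intro conjI impI)
  have V: "finite V" and E: "E = {e. e \<subseteq> V \<and> card e = r}"
    using assms(1)
    by (auto simp: complete_uniform_hypergraph_def uniform_hypergraph_def hypergraph_def)
  have finE: "finite E" and cardE: "card E = n choose r"
    using V n_subsets[OF V] assms(2) by (auto simp: E)
  have ne: "{} \<notin> E"
    using assms(3) by (auto simp: E)
  show "edge_domatic_number E = n choose r" if "r > n div 2"
  proof (rule edge_domatic_number_eqI[OF finE partition_on_singletons])
    show "edge_dominating E D" if "D \<in> (\<lambda>e. {e}) ` E" for D
    proof -
      have "e \<inter> f \<noteq> {}" if "e \<in> E" "f \<in> E" for e f
      proof
        assume "e \<inter> f = {}"
        then have "card (e \<union> f) = r + r"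
          using that V by (subst card_Un_disjoint) (auto simp: E intro: finite_subset)
        moreover have "card (e \<union> f) \<le> n"
          using that V assms(2) by (auto simp: E intro!: card_mono)
        ultimately show False
          using \<open>r > n div 2\<close> by linarith
      qed
      then show ?thesis
        using that by (auto simp: edge_dominating_def adjacent_edges_def)
    qed
    show "card ((\<lambda>e. {e}) ` E) = n choose r"
      by (simp add: card_image cardE)
    show "card Q \<le> n choose r" if "partition_on E Q" for Q
    proof -
      have "1 \<le> card D" if "D \<in> Q" for D
        using that \<open>partition_on E Q\<close> finE
        by (metis One_nat_def Suc_leI Union_upper card_gt_0_iff finite_subset partition_onD1
            partition_onD3)
      from card_partition_on_mult_le[OF finE \<open>partition_on E Q\<close> this] show ?thesis
        using cardE by simp
    qed
  qed
  show "real (edge_domatic_number E) = real (n choose r) / (real n / real r)"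
    if "r \<le> n div 2 \<and> r dvd n"
  proof -
    obtain k where n: "n = k * r"
      using \<open>r \<le> n div 2 \<and> r dvd n\<close> by (metis dvdE mult.commute)
    have "0 < k" "0 < r"
      using n assms(3,4) by (auto intro: Nat.gr0I)
    \<comment> \<open>The value of \<open>(n choose r) / k\<close> without division, by the identity
      \<open>r * (n choose r) = n * ((n - 1) choose (r - 1))\<close>.\<close>
    define M where "M = (n - 1) choose (r - 1)"
    have M: "M * k = n choose r"
      using times_binomial_minus1_eq[of r n] \<open>0 < r\<close> by (simp add: M_def n mult.commute)
    obtain P where P: "partition_on E P" "card P = M" "\<And>D. D \<in> P \<Longrightarrow> \<Union>D = V"
      using baranyai[OF V, of k r M] assms(2) \<open>0 < k\<close> M by (auto simp: n E)
    have "edge_domatic_number E = M"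
    proof (rule edge_domatic_number_eqI[OF finE P(1) _ P(2)])
      show "edge_dominating E D" if "D \<in> P" for D
        using that P(3) partition_onD1[OF P(1)] ne
        by (intro edge_dominating_if_covering[where V = V]) (auto simp: E)
      show "card Q \<le> M" if Q: "partition_on E Q" "\<And>D. D \<in> Q \<Longrightarrow> edge_dominating E D" for Q
      proof -
        have "card Q * k \<le> M * k"
          using card_partition_on_mult_le[OF finE Q(1), of k]
            edge_dominating_card_ge[OF E V _ \<open>0 < r\<close> Q(2), of k]
          by (simp add: cardE M assms(2) n)
        then show ?thesis using \<open>0 < k\<close> by simp
      qed
    qed
    moreover have "real n / real r = real k"
      using n \<open>0 < r\<close> by simp
    moreover have "real (n choose r) = real M * real k"
      by (simp flip: M)
    ultimately show ?thesis
      using \<open>0 < k\<close> by simp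
  qed
qed

end
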